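(* For real $x$ put $$c(x)=\left(\frac{160}{\pi^5}-\frac{16}{\pi^3}\right)\left(\frac{\pi}{2}-x\right),$$ $$d(x)=\left(\frac{160}{\pi^5}-\frac{16}{\pi^3}\right)\left(\frac{\pi}{2}-x\right)+\left(\frac{960}{\pi^6}-\frac{96}{\pi^4}\right)\left(\frac{\pi}{2}-x\right)^{2}.$$ Then for every $x\in\left(0,\frac{\pi}{2}\right)$ the following inequalities hold: $$2+\left(\frac{16}{\pi^4}+c(x)\right)x^3\tan x<\left(\frac{\sin x}{x}\right)^{2}+\frac{\tan x}{x}<2+\left(\frac{16}{\pi^4}+d(x)\right)x^3\tan x .$$
   Context: All quantities are real. *)

theory Defs
  imports Complex_Main
begin

definition c :: "real \<Rightarrow> real" where
  "c x = (160 / pi ^ 5 - 16 / pi ^ 3) * (pi / 2 - x)"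

definition d :: "real \<Rightarrow> real" where
  "d x = (160 / pi ^ 5 - 16 / pi ^ 3) * (pi / 2 - x)
       + (960 / pi ^ 6 - 96 / pi ^ 4) * (pi / 2 - x) ^ 2"

end

theory Submission
  imports Defs
begin

text \<open>
  Write \<open>p = \<pi>/2\<close> and \<open>t = p - x\<close>. Subtracting \<open>2\<close> and dividing by the positive number
  \<open>x\<^sup>3 tan x\<close> turns the middle expression (by \<open>gap_factorisation\<close>) into
  \<open>E(x) = (x + sin (2x)/2 - 2 x\<^sup>2 cot x) / x\<^sup>5\<close>, so the claim is that
  \<open>q + a t < E(x) < q + a t + b t\<^sup>2\<close>, where \<open>q = 1/p^4\<close>, \<open>a = 5/p^5 - 2/p^3\<close> and
  \<open>b = 15/p^6 - 6/p^4\<close> are the first three Taylor coefficients of \<open>E\<close> in \<open>t\<close> at \<open>t = 0\<close>.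
  The lower gap therefore vanishes to order exactly \<open>t\<^sup>2\<close> at \<open>x = \<pi>/2\<close> and the upper one to order
  \<open>t\<^sup>3\<close>, while at \<open>x = 0\<close> the numerator \<open>x\<^sup>5 E(x)\<close> vanishes to order \<open>x\<^sup>5\<close>, with
  \<open>E(x) = 8/45 - 8 x\<^sup>2/945 + \<dots>\<close>. These zeros have to be divided out exactly, and a Taylor
  polynomial does that only at its own centre; so the interval is cut near \<open>x = 1\<close>.

  To the left of the cut, Taylor bounds for \<open>sin (2x)\<close> and \<open>cot x\<close> at \<open>0\<close> bound \<open>E(x)\<close> by
  polynomials in \<open>x\<close> (\<open>numer_lower_small\<close>, \<open>numer_upper_small\<close>), and those are compared with the
  linear or quadratic polynomial in \<open>t\<close>. To the right, \<open>sin (2x) = sin (2t)\<close> and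
  \<open>cot x = tan t\<close> are replaced by polynomials in \<open>t\<close>. Because \<open>q\<close>, \<open>a\<close>, \<open>b\<close> are the exact Taylor
  coefficients, the resulting polynomial gap is divisible by \<open>t\<^sup>2\<close> or \<open>t\<^sup>3\<close> identically in \<open>p\<close>;
  the cofactor stays away from zero, so that a four-digit enclosure of \<open>\<pi>\<close> decides its sign
  (\<open>lower_poly_large\<close>, \<open>upper_poly_large\<close>).
\<close>

section \<open>Taylor bounds for sine and cosine\<close>

text \<open>
  The Lagrange remainder after an even number \<open>2j\<close> of terms involves
  \<open>sin (s + j \<pi>) = (-1)^j sin s\<close> with \<open>0 < s < x\<close>, so for \<open>x < \<pi>\<close> its sign is known.
\<close>

lemma sin_taylor_sign:
  fixes x :: real
  assumes "0 < x" "x < pi" "0 < j"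
  shows "0 \<le> (-1) ^ j * (sin x - (\<Sum>m<2*j. sin_coeff m * x ^ m))"
proof -
  obtain t where t: "0 < t" "t < x"
    "sin x = (\<Sum>m<2*j. sin_coeff m * x ^ m)
      + (sin (t + 1/2 * real (2*j) * pi) / fact (2*j)) * x ^ (2*j)"
    using Maclaurin_sin_expansion3[of "2*j" x] assms by auto
  have "sin (t + 1/2 * real (2*j) * pi) = (-1) ^ j * sin t"
    by (simp add: sin_add sin_npi)
  moreover have "0 < sin t"
    using t assms by (intro sin_gt_zero) auto
  ultimately show ?thesis
    using t(3) assms by (simp add: power_mult_distrib[symmetric] flip: mult.assoc)
qed

text \<open>
  The order \<open>2j + 1\<close> makes the remainder of the cosine a sine again; this yields the whole range
  \<open>x < \<pi>\<close>, whereas an even order would only work up to \<open>\<pi>/2\<close>.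
\<close>

lemma cos_taylor_sign:
  fixes x :: real
  assumes "0 < x" "x < pi"
  shows "0 \<le> (-1) ^ j * ((\<Sum>m<2*j+1. cos_coeff m * x ^ m) - cos x)"
proof -
  obtain t where t: "0 < t" "t < x"
    "cos x = (\<Sum>m<2*j+1. cos_coeff m * x ^ m)
      + (cos (t + 1/2 * real (2*j+1) * pi) / fact (2*j+1)) * x ^ (2*j+1)"
    using Maclaurin_cos_expansion2[of x "2*j+1"] assms by auto
  have "t + 1/2 * real (2*j+1) * pi = (t + pi / 2) + real j * pi"
    by (simp add: field_simps)
  then have "cos (t + 1/2 * real (2*j+1) * pi) = - ((-1) ^ j * sin t)"
    by (simp only: cos_add[of "t + pi / 2"]) (simp add: cos_add)
  moreover have "0 < sin t"
    using t assms by (intro sin_gt_zero) auto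
  ultimately show ?thesis
    using t(3) assms by (simp add: power_mult_distrib[symmetric] flip: mult.assoc)
qed


lemma sin_taylor_bounds:
  fixes x :: real
  assumes "0 < x" "x < pi"
  shows "sin x \<le> x - x^3/6 + x^5/120"
    and "sin x \<ge> x - x^3/6 + x^5/120 - x^7/5040"
    and "sin x \<le> x - x^3/6 + x^5/120 - x^7/5040 + x^9/362880"
  using sin_taylor_sign[OF assms, of 3] sin_taylor_sign[OF assms, of 4]
    sin_taylor_sign[OF assms, of 5]
  by (simp_all add: sin_coeff_def fact_numeral lessThan_nat_numeral lessThan_Suc)

lemma cos_taylor_bounds:
  fixes x :: real
  assumes "0 < x" "x < pi"
  shows "cos x \<le> 1 - x^2/2 + x^4/24"
    and "cos x \<ge> 1 - x^2/2 + x^4/24 - x^6/720"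
    and "cos x \<le> 1 - x^2/2 + x^4/24 - x^6/720 + x^8/40320"
    and "cos x \<ge> 1 - x^2/2 + x^4/24 - x^6/720 + x^8/40320 - x^10/3628800"
  using cos_taylor_sign[OF assms, of 2] cos_taylor_sign[OF assms, of 3]
    cos_taylor_sign[OF assms, of 4] cos_taylor_sign[OF assms, of 5]
  by (simp_all add: cos_coeff_def fact_numeral lessThan_nat_numeral lessThan_Suc)

section \<open>An enclosure of pi\<close>

text \<open>
  The slope \<open>a = 16 (10 - \<pi>\<^sup>2)/\<pi>^5\<close> is small because \<open>\<pi>\<^sup>2\<close> is close to \<open>10\<close>, so coarse bounds
  such as \<open>3 < \<pi> < 22/7\<close> do not suffice. Four digits come from comparing \<open>sin (\<pi>/6) = 1/2\<close> with
  the Taylor bounds of the sine near \<open>\<pi>/6\<close>.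
\<close>

lemma pi_bounds: "31415/10000 < pi" "pi < 31416/10000"
proof -
  show "31415/10000 < pi"
  proof (rule ccontr)
    let ?u = "31415/60000 :: real"
    assume "\<not> 31415/10000 < pi"
    then have "pi/6 \<le> ?u" by simp
    moreover have "sin ?u \<le> ?u - ?u^3/6 + ?u^5/120"
      using pi_ge_two by (intro sin_taylor_bounds) auto
    then have "sin ?u < 1/2" by (simp add: power_divide)
    moreover have "sin (pi/6) \<le> sin ?u"
      using calculation pi_ge_two by (intro sin_monotone_2pi_le) auto
    ultimately show False by (simp add: sin_30)
  qed
  show "pi < 31416/10000"
  proof (rule ccontr)
    let ?u = "31416/60000 :: real"
    assume "\<not> pi < 31416/10000"
    then have "?u \<le> pi/6" by simp
    moreover have "?u - ?u^3/6 + ?u^5/120 - ?u^7/5040 \<le> sin ?u"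
      using pi_ge_two by (intro sin_taylor_bounds) auto
    then have "1/2 < sin ?u" by (simp add: power_divide)
    moreover have "sin ?u \<le> sin (pi/6)"
      using calculation pi_ge_two by (intro sin_monotone_2pi_le) auto
    ultimately show False by (simp add: sin_30)
  qed
qed

section \<open>Polynomial bounds for tangent and cotangent\<close>

text \<open>
  All four bounds in this part are proved alike: with numerator and denominator
  replaced by Taylor polynomials, the claimed inequality becomes polynomial, and the difference of
  its two sides is an explicit high power of the variable times a factor whose sign is plain on
  the given interval.
\<close>

lemma tan_lower:
  fixes t :: real
  assumes "0 < t" "t \<le> 1"
  shows "t + t^3/3 + 2*t^5/15 \<le> tan t"
proof -
  have pi: "t < pi / 2" using assms pi_bounds by linarith
  have cos: "0 < cos t" using assms pi by (intro cos_gt_zero) auto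
  have "(t + t^3/3 + 2*t^5/15) * cos t \<le> (t + t^3/3 + 2*t^5/15) * (1 - t^2/2 + t^4/24)"
    using assms pi by (intro mult_left_mono cos_taylor_bounds) auto
  also have "\<dots> = (t - t^3/6 + t^5/120 - t^7/5040) - t^7 * (53/1008 - t^2/180)"
    by (simp add: field_simps power_numeral_reduce)
  also have "\<dots> \<le> t - t^3/6 + t^5/120 - t^7/5040"
    using assms power_le_one[of t 2] by simp
  also have "\<dots> \<le> sin t"
    using assms pi by (intro sin_taylor_bounds) auto
  finally show ?thesis
    using cos by (simp add: tan_def field_simps)
qed

text \<open>
  The true coefficient \<open>2/15\<close> of \<open>t^5\<close> is raised to \<open>31/200\<close> to absorb the rest of the series;
  the bound on \<open>t\<close> is just above \<open>\<pi>/2 - 1\<close>, the range needed for \<open>x > 1\<close>.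
\<close>

lemma tan_upper:
  fixes t :: real
  assumes "0 < t" "t \<le> 571/1000"
  shows "tan t \<le> t + t^3/3 + 31*t^5/200"
proof -
  have pi: "t < pi / 2" using assms pi_bounds by linarith
  have cos: "0 < cos t" using assms pi by (intro cos_gt_zero) auto
  have t2: "t^2 \<le> (571/1000)^2" using assms by (intro power_mono) auto
  have "sin t \<le> t - t^3/6 + t^5/120"
    using assms pi by (intro sin_taylor_bounds) auto
  also have "\<dots> \<le> t - t^3/6 + t^5/120
      + t^5 * ((13/600 - 13*t^2/200) + t^4 * (259/43200 - 31*t^2/144000))"
    using assms t2 by (simp add: power2_eq_square)
  also have "\<dots> = (t + t^3/3 + 31*t^5/200) * (1 - t^2/2 + t^4/24 - t^6/720)"
    by (simp add: field_simps power_numeral_reduce)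
  also have "\<dots> \<le> (t + t^3/3 + 31*t^5/200) * cos t"
    using assms pi by (intro mult_left_mono cos_taylor_bounds) auto
  finally show ?thesis
    using cos by (simp add: tan_def field_simps)
qed


lemma cot_upper:
  fixes x :: real
  assumes "0 < x" "x \<le> 1"
  shows "cot x \<le> 1/x - x/3 - x^3/45 - 2*x^5/945"
proof -
  have pi: "x < pi" using assms pi_bounds by linarith
  have sin: "0 < sin x" using assms pi by (intro sin_gt_zero) auto
  have pw: "x^2 \<le> 1" "x^4 \<le> 1" "x^6 \<le> 1" using assms by (auto intro: power_le_one)
  have "x * cos x \<le> x * (1 - x^2/2 + x^4/24 - x^6/720 + x^8/40320)"
    using assms pi by (intro mult_left_mono cos_taylor_bounds) auto
  also have "\<dots> \<le> x * (1 - x^2/2 + x^4/24 - x^6/720 + x^8/40320)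
      + x^9 * (379/1814400 - x^2/75600 + x^4/2381400)"
    using assms pw zero_le_power[of x 4] by simp
  also have "\<dots> = (x - x^3/6 + x^5/120 - x^7/5040) * (1 - x^2/3 - x^4/45 - 2*x^6/945)"
    by (simp add: field_simps power_numeral_reduce)
  also have "\<dots> \<le> sin x * (1 - x^2/3 - x^4/45 - 2*x^6/945)"
    using assms pi pw by (intro mult_right_mono sin_taylor_bounds) auto
  finally show ?thesis
    using sin assms by (simp add: cot_def field_simps power_numeral_reduce)
qed

text \<open>
  Here \<open>1/4000\<close> replaces the true coefficient \<open>1/4725\<close> of \<open>x^7\<close> to absorb the rest of the series.
\<close>

lemma cot_lower:
  fixes x :: real
  assumes "0 < x" "x \<le> 11/10"
  shows "1/x - x/3 - x^3/45 - 2*x^5/945 - x^7/4000 \<le> cot x"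
proof -
  have pi: "x < pi" using assms pi_bounds by linarith
  have sin: "0 < sin x" using assms pi by (intro sin_gt_zero) auto
  have pw: "x^n \<le> (11/10)^n" for n using assms by (intro power_mono) auto
  have C: "0 \<le> 1 - x^2/3 - x^4/45 - 2*x^6/945 - x^8/4000"
    using pw[of 2] pw[of 4] pw[of 6] pw[of 8] by (simp add: power_divide)
  have "sin x * (1 - x^2/3 - x^4/45 - 2*x^6/945 - x^8/4000)
      \<le> (x - x^3/6 + x^5/120 - x^7/5040 + x^9/362880)
        * (1 - x^2/3 - x^4/45 - 2*x^6/945 - x^8/4000)"
    using assms pi C by (intro mult_right_mono sin_taylor_bounds) auto
  also have "\<dots> \<le> (x - x^3/6 + x^5/120 - x^7/5040 + x^9/362880)
        * (1 - x^2/3 - x^4/45 - 2*x^6/945 - x^8/4000)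
      + x^9 * ((29/756000 - 1513*x^2/54432000)
        + x^4 * (9857/5715360000 - 1501*x^2/34292160000) + x^8/1451520000)"
    using assms pw[of 2] by (simp add: power_divide)
  also have "\<dots> = x * (1 - x^2/2 + x^4/24 - x^6/720 + x^8/40320 - x^10/3628800)"
    by (simp add: field_simps power_numeral_reduce)
  also have "\<dots> \<le> x * cos x"
    using assms pi by (intro mult_left_mono cos_taylor_bounds) auto
  finally show ?thesis
    using sin assms by (simp add: cot_def field_simps power_numeral_reduce)
qed

section \<open>Reduction to a quotient by the fifth power\<close>

text \<open>
  This is \<open>x^5\<close> times the quotient \<open>((sin x/x)\<^sup>2 + tan x/x - 2) / (x\<^sup>3 tan x)\<close>.
\<close>

definition numer :: "real \<Rightarrow> real" where
  "numer x = x + sin (2*x) / 2 - 2 * x^2 * cot x"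

lemma gap_factorisation:
  fixes x A :: real
  assumes "0 < x" "x < pi / 2"
  shows "(sin x / x)^2 + tan x / x - (2 + A * x^3 * tan x)
    = tan x / x^2 * (numer x - A * x^5)"
proof -
  have "0 < sin x" "0 < cos x"
    using assms by (auto intro: sin_gt_zero cos_gt_zero)
  then show ?thesis
    using assms unfolding numer_def sin_double
    by (simp add: tan_def cot_def field_simps power_numeral_reduce)
qed

lemma numer_complement:
  "numer (pi/2 - t) = pi/2 - t + sin (2*t) / 2 - 2 * (pi/2 - t)^2 * tan t"
proof -
  have "sin (2 * (pi/2 - t)) = sin (2*t)"
    by (simp add: right_diff_distrib)
  moreover have "cot (pi/2 - t) = tan t"
    by (simp add: tan_def cot_def sin_diff cos_diff)
  ultimately show ?thesis by (simp add: numer_def)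
qed

section \<open>The numerator near zero\<close>

text \<open>
  In \<open>numer x\<close> all terms below \<open>x^5\<close> cancel, and \<open>numer x / x^5 = 8/45 - 8 x\<^sup>2/945 + \<dots>\<close>. The next
  coefficient is positive, which is why truncation after \<open>x\<^sup>2\<close> gives a lower bound.
\<close>

lemma numer_lower_small:
  fixes x :: real
  assumes "0 < x" "x \<le> 1"
  shows "(8/45 - 8*x^2/945) * x^5 \<le> numer x"
proof -
  have "(8/45 - 8*x^2/945) * x^5 = x + (2*x - (2*x)^3/6 + (2*x)^5/120 - (2*x)^7/5040) / 2
      - 2 * x^2 * (1/x - x/3 - x^3/45 - 2*x^5/945)"
    using assms by (simp add: field_simps power_numeral_reduce)
  also have "\<dots> \<le> x + sin (2*x) / 2 - 2 * x^2 * cot x"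
    using assms pi_bounds
    by (intro diff_mono add_mono divide_right_mono mult_left_mono sin_taylor_bounds cot_upper) auto
  finally show ?thesis unfolding numer_def .
qed

lemma numer_upper_small:
  fixes x :: real
  assumes "0 < x" "x \<le> 11/10"
  shows "numer x \<le> (8/45 - 8*x^2/945 + (2/2835 + 1/2000) * x^4) * x^5"
proof -
  have "x + sin (2*x) / 2 - 2 * x^2 * cot x
      \<le> x + (2*x - (2*x)^3/6 + (2*x)^5/120 - (2*x)^7/5040 + (2*x)^9/362880) / 2
        - 2 * x^2 * (1/x - x/3 - x^3/45 - 2*x^5/945 - x^7/4000)"
    using assms pi_bounds
    by (intro diff_mono add_mono divide_right_mono mult_left_mono sin_taylor_bounds cot_lower) auto
  also have "\<dots> = (8/45 - 8*x^2/945 + (2/2835 + 1/2000) * x^4) * x^5"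
    using assms by (simp add: field_simps power_numeral_reduce)
  finally show ?thesis unfolding numer_def .
qed

section \<open>The polynomial inequalities\<close>

lemma inverse_power_bounds:
  fixes p :: real
  assumes "157075/100000 < p" "p < 15708/10000"
  shows "1 / (15708/10000) ^ n \<le> 1 / p ^ n" "1 / p ^ n \<le> 1 / (157075/100000) ^ n"
  using assms by (auto intro!: divide_left_mono power_mono)

lemma taylor_coefficient_bounds:
  fixes p :: real
  assumes "157075/100000 < p" "p < 15708/10000"
  shows "16425/100000 \<le> 1/p^4" "1/p^4 \<le> 16428/100000"
    and "676/100000 \<le> 5/p^5 - 2/p^3" "5/p^5 - 2/p^3 \<le> 690/100000"
    and "1289/100000 \<le> 15/p^6 - 6/p^4"
  using inverse_power_bounds[OF assms, of 3] inverse_power_bounds[OF assms, of 4]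
    inverse_power_bounds[OF assms, of 5] inverse_power_bounds[OF assms, of 6]
  by (simp_all add: power_divide)

text \<open>
  The two sides differ by about \<open>0.0028\<close> at \<open>x = 0\<close> and \<open>0.0012\<close> at \<open>x = 1\<close>, and the difference is
  concave, so replacing \<open>x\<^sup>2\<close> by its chord \<open>x\<close> leaves a linear inequality that still holds.
\<close>

lemma lower_poly_small:
  fixes p x :: real
  assumes p: "157075/100000 < p" "p < 15708/10000" and x: "0 < x" "x \<le> 1"
  shows "1/p^4 + (5/p^5 - 2/p^3) * (p - x) < 8/45 - 8*x^2/945"
proof -
  have "(5/p^5 - 2/p^3) * (p - x) \<le> 690/100000 * (15708/10000 - x)"
    using p x taylor_coefficient_bounds[OF p] by (intro mult_mono) auto
  moreover have "x^2 \<le> x"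
    using x by (simp add: power2_eq_square)
  ultimately show ?thesis
    using taylor_coefficient_bounds[OF p] x by simp
qed

text \<open>
  The difference of the two sides decreases to about \<open>0.001\<close> at \<open>x = 11/10\<close>. Written in the
  distance \<open>w\<close> to that point it becomes, after \<open>x^4 \<le> (11/10)\<^sup>2 x\<^sup>2\<close>, a quadratic with positive
  coefficients.
\<close>

lemma upper_poly_small:
  fixes p x :: real
  assumes p: "157075/100000 < p" "p < 15708/10000" and x: "0 < x" "x \<le> 11/10"
  shows "8/45 - 8*x^2/945 + (2/2835 + 1/2000) * x^4
    < 1/p^4 + (5/p^5 - 2/p^3) * (p - x) + (15/p^6 - 6/p^4) * (p - x)^2"
proof -
  define w where "w = 11/10 - x"
  have w: "0 \<le> w" and xw: "x = 11/10 - w" using x by (auto simp: w_def)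
  have t: "47075/100000 + w \<le> p - x" using p by (simp add: w_def)
  have linear: "676/100000 * (47075/100000 + w) \<le> (5/p^5 - 2/p^3) * (p - x)"
    using t w taylor_coefficient_bounds[OF p] by (intro mult_mono) auto
  have quadratic: "1289/100000 * (47075/100000 + w)^2 \<le> (15/p^6 - 6/p^4) * (p - x)^2"
    using t w taylor_coefficient_bounds[OF p] by (intro mult_mono power_mono) auto
  have x4: "x^4 \<le> 121/100 * x^2"
  proof -
    have "x^2 * x^2 \<le> (11/10)^2 * x^2"
      using x by (intro mult_right_mono power_mono) auto
    then show ?thesis by (simp add: power_divide power_numeral_reduce)
  qed
  let ?excess = "897628483607/907200000000000 + 394694429/113400000000*w + 2256319/113400000*w^2"
  have "8/45 - 8*x^2/945 + (2/2835 + 1/2000) * x^4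
      \<le> 8/45 - 8*x^2/945 + (2/2835 + 1/2000) * (121/100 * x^2)"
    using x4 by (intro add_left_mono mult_left_mono) auto
  also have "\<dots> < 8/45 - 8*x^2/945 + (2/2835 + 1/2000) * (121/100 * x^2) + ?excess"
    using w by (intro less_add_same_cancel1[THEN iffD2] add_pos_nonneg) auto
  also have "\<dots> = 16425/100000 + 676/100000 * (47075/100000 + w)
      + 1289/100000 * (47075/100000 + w)^2"
    unfolding xw by (simp add: field_simps power_numeral_reduce)
  also have "\<dots> \<le> 1/p^4 + (5/p^5 - 2/p^3) * (p - x) + (15/p^6 - 6/p^4) * (p - x)^2"
    using linear quadratic taylor_coefficient_bounds(1)[OF p] by (intro add_mono) auto
  finally show ?thesis .
qed

text \<open>
  The gap is \<open>t\<^sup>2\<close> times a quintic in \<open>t\<close>, whose constant term is \<open>b p^5\<close>. On the interval the quintic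
  falls from about \<open>0.124\<close> to about \<open>0.005\<close>, so rounding its coefficients down to three decimals
  keeps it positive. Its coefficients alternate in sign in \<open>t\<close>, but not in the distance \<open>w\<close> to the
  right end point: there a single coefficient is negative, that of \<open>w^3\<close>, and it is small
  enough to be absorbed by the \<open>w\<^sup>2\<close> term.
\<close>

lemma lower_poly_large:
  fixes p t :: real
  assumes p: "157075/100000 < p" "p < 15708/10000" and t: "0 < t" "t \<le> 3/5"
  shows "(1/p^4 + (5/p^5 - 2/p^3) * t) * (p - t)^5
    < p - 2*t^3/3 + 2*t^5/15 - 4*t^7/315 - 2 * (p - t)^2 * (t + t^3/3 + 31*t^5/200)"
proof -
  define w where "w = 3/5 - t"
  let ?shifted = "1792/390625 + 269/62500*w + w^2 * (6273/25000 - w/5000) + 11/1000*w^4 + 323/1000*w^5"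
  have w: "0 \<le> w" "w \<le> 3/5" and tw: "t = 3/5 - w" using t by (auto simp: w_def)
  note inv = inverse_power_bounds[OF p, of 1] inverse_power_bounds[OF p, of 2]
    inverse_power_bounds[OF p, of 3] inverse_power_bounds[OF p, of 4]
    inverse_power_bounds[OF p, of 5]
  have p2: "(157075/100000)^2 \<le> p^2" "p^2 \<le> (15708/10000)^2"
    using p by (auto intro: power_mono)
  have "124/1000 \<le> 15/p - 6*p"
    "-524/1000 \<le> 52/3 - 40/p^2 - 2*p^2/3"
    "972/1000 \<le> 45/p^3 - 20/p + 4*p/3"
    "-1189/1000 \<le> 10/p^2 - 24/p^4 - 8/15 - 31*p^2/100"
    "980/1000 \<le> 5/p^5 - 2/p^3 + 31*p/50"
    "-323/1000 \<le> (-4/315 - 31/100 :: real)"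
    using inv p p2 by (simp_all add: power_divide)
  then have "124/1000 + (-524/1000)*t + 972/1000*t^2 + (-1189/1000)*t^3 + 980/1000*t^4
      + (-323/1000)*t^5
    \<le> (15/p - 6*p) + (52/3 - 40/p^2 - 2*p^2/3)*t + (45/p^3 - 20/p + 4*p/3)*t^2
      + (10/p^2 - 24/p^4 - 8/15 - 31*p^2/100)*t^3 + (5/p^5 - 2/p^3 + 31*p/50)*t^4
      + (-4/315 - 31/100)*t^5"
    using t by (intro add_mono mult_right_mono) auto
  moreover have "124/1000 + (-524/1000)*t + 972/1000*t^2 + (-1189/1000)*t^3 + 980/1000*t^4
      + (-323/1000)*t^5 = ?shifted"
    unfolding tw by (simp add: field_simps power_numeral_reduce)
  moreover have "0 < ?shifted"
    using w by (intro add_pos_nonneg) auto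
  ultimately have "0 < t^2 * ((15/p - 6*p) + (52/3 - 40/p^2 - 2*p^2/3)*t
      + (45/p^3 - 20/p + 4*p/3)*t^2 + (10/p^2 - 24/p^4 - 8/15 - 31*p^2/100)*t^3
      + (5/p^5 - 2/p^3 + 31*p/50)*t^4 + (-4/315 - 31/100)*t^5)"
    using t by (intro mult_pos_pos) auto
  also have "\<dots> = p - 2*t^3/3 + 2*t^5/15 - 4*t^7/315 - 2 * (p - t)^2 * (t + t^3/3 + 31*t^5/200)
      - (1/p^4 + (5/p^5 - 2/p^3) * t) * (p - t)^5"
    using p by (simp add: divide_simps) (simp add: algebra_simps power_numeral_reduce)
  finally show ?thesis by simp
qed

text \<open>
  Since \<open>b\<close> matches the second Taylor coefficient as well, the gap is now \<open>t\<^sup>3\<close> times a quartic.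
  After rounding it falls from \<open>0.125\<close> to about \<open>0.002\<close>, and in the distance \<open>w\<close> to the right end
  point all its coefficients are positive.
\<close>

lemma upper_poly_large:
  fixes p t :: real
  assumes p: "157075/100000 < p" "p < 15708/10000" and t: "0 < t" "t \<le> 1/2"
  shows "p - 2*t^3/3 + 2*t^5/15 - 2 * (p - t)^2 * (t + t^3/3 + 2*t^5/15)
    < (1/p^4 + (5/p^5 - 2/p^3) * t + (15/p^6 - 6/p^4) * t^2) * (p - t)^5"
proof -
  define w where "w = 1/2 - t"
  let ?shifted = "37/16000 + 289/2000*w + 39/2000*w^2 + 119/500*w^3 + 253/1000*w^4"
  have w: "0 \<le> w" and tw: "t = 1/2 - w" using t by (auto simp: w_def)
  note inv = inverse_power_bounds[OF p, of 1] inverse_power_bounds[OF p, of 2]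
    inverse_power_bounds[OF p, of 3] inverse_power_bounds[OF p, of 4]
    inverse_power_bounds[OF p, of 5] inverse_power_bounds[OF p, of 6]
  have p2: "(157075/100000)^2 \<le> p^2" "p^2 \<le> (15708/10000)^2"
    using p by (auto intro: power_mono)
  have "125/1000 \<le> 38/3 - 35/p^2 + 2*p^2/3"
    "-469/1000 \<le> 105/p^3 - 40/p - 4*p/3"
    "756/1000 \<le> 50/p^2 - 126/p^4 + 8/15 + 4*p^2/15"
    "-744/1000 \<le> 70/p^5 - 28/p^3 - 8*p/15"
    "253/1000 \<le> 4/15 - 15/p^6 + 6/p^4"
    using inv p p2 by (simp_all add: power_divide)
  then have "125/1000 + (-469/1000)*t + 756/1000*t^2 + (-744/1000)*t^3 + 253/1000*t^4
    \<le> (38/3 - 35/p^2 + 2*p^2/3) + (105/p^3 - 40/p - 4*p/3)*t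
      + (50/p^2 - 126/p^4 + 8/15 + 4*p^2/15)*t^2 + (70/p^5 - 28/p^3 - 8*p/15)*t^3
      + (4/15 - 15/p^6 + 6/p^4)*t^4"
    using t by (intro add_mono mult_right_mono) auto
  moreover have "125/1000 + (-469/1000)*t + 756/1000*t^2 + (-744/1000)*t^3 + 253/1000*t^4 = ?shifted"
    unfolding tw by (simp add: field_simps power_numeral_reduce)
  moreover have "0 < ?shifted"
    using w by (intro add_pos_nonneg) auto
  ultimately have "0 < t^3 * ((38/3 - 35/p^2 + 2*p^2/3) + (105/p^3 - 40/p - 4*p/3)*t
      + (50/p^2 - 126/p^4 + 8/15 + 4*p^2/15)*t^2 + (70/p^5 - 28/p^3 - 8*p/15)*t^3
      + (4/15 - 15/p^6 + 6/p^4)*t^4)"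
    using t by (intro mult_pos_pos) auto
  also have "\<dots> = (1/p^4 + (5/p^5 - 2/p^3) * t + (15/p^6 - 6/p^4) * t^2) * (p - t)^5
      - (p - 2*t^3/3 + 2*t^5/15 - 2 * (p - t)^2 * (t + t^3/3 + 2*t^5/15))"
    using p by (simp add: divide_simps) (simp add: algebra_simps power_numeral_reduce)
  finally show ?thesis by simp
qed

section \<open>The two inequalities on the whole interval\<close>

text \<open>
  The cut at \<open>x = 1\<close> is a compromise: the quadratic minorant of \<open>numer x / x^5\<close> is too weak much
  beyond \<open>11/10\<close>, and the truncated tangent is too inaccurate for large \<open>t\<close>.
\<close>

lemma numer_lower:
  fixes x :: real
  defines "p \<equiv> pi / 2"
  assumes "0 < x" "x < pi / 2"
  shows "(1/p^4 + (5/p^5 - 2/p^3) * (p - x)) * x^5 < numer x"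
proof (cases "x \<le> 1")
  case True
  have "(1/p^4 + (5/p^5 - 2/p^3) * (p - x)) * x^5 < (8/45 - 8*x^2/945) * x^5"
    using lower_poly_small[of p x] assms True pi_bounds by (intro mult_strict_right_mono) auto
  also have "\<dots> \<le> numer x"
    using assms True by (intro numer_lower_small) auto
  finally show ?thesis .
next
  case False
  define t where "t = p - x"
  have t: "0 < t" "t \<le> 571/1000" and x: "x = p - t"
    using assms False pi_bounds by (auto simp: t_def)
  have "(1/p^4 + (5/p^5 - 2/p^3) * t) * (p - t)^5
      < p - 2*t^3/3 + 2*t^5/15 - 4*t^7/315 - 2 * (p - t)^2 * (t + t^3/3 + 31*t^5/200)"
    using t pi_bounds by (intro lower_poly_large) (auto simp: p_def)
  moreover have "2*t - (2*t)^3/6 + (2*t)^5/120 - (2*t)^7/5040 \<le> sin (2*t)"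
    using t pi_bounds by (intro sin_taylor_bounds) auto
  moreover have "2 * (p - t)^2 * tan t \<le> 2 * (p - t)^2 * (t + t^3/3 + 31*t^5/200)"
    using t by (intro mult_left_mono tan_upper) auto
  moreover have "numer x = p - t + sin (2*t) / 2 - 2 * (p - t)^2 * tan t"
    unfolding x p_def by (rule numer_complement)
  ultimately show ?thesis
    unfolding t_def[symmetric] by (simp add: x power_mult_distrib)
qed

text \<open>
  The cut moves right to \<open>11/10\<close>, because the gap of order \<open>t\<^sup>3\<close> leaves less room for the truncation
  error of the tangent, which is of order \<open>t^7\<close>.
\<close>

lemma numer_upper:
  fixes x :: real
  defines "p \<equiv> pi / 2"
  assumes "0 < x" "x < pi / 2"
  shows "numer x < (1/p^4 + (5/p^5 - 2/p^3) * (p - x) + (15/p^6 - 6/p^4) * (p - x)^2) * x^5"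
proof (cases "x \<le> 11/10")
  case True
  have "numer x \<le> (8/45 - 8*x^2/945 + (2/2835 + 1/2000) * x^4) * x^5"
    using assms True by (intro numer_upper_small) auto
  also have "\<dots> < (1/p^4 + (5/p^5 - 2/p^3) * (p - x) + (15/p^6 - 6/p^4) * (p - x)^2) * x^5"
    using upper_poly_small[of p x] assms True pi_bounds by (intro mult_strict_right_mono) auto
  finally show ?thesis .
next
  case False
  define t where "t = p - x"
  have t: "0 < t" "t \<le> 1/2" and x: "x = p - t"
    using assms False pi_bounds by (auto simp: t_def)
  have "p - 2*t^3/3 + 2*t^5/15 - 2 * (p - t)^2 * (t + t^3/3 + 2*t^5/15)
      < (1/p^4 + (5/p^5 - 2/p^3) * t + (15/p^6 - 6/p^4) * t^2) * (p - t)^5"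
    using t pi_bounds by (intro upper_poly_large) (auto simp: p_def)
  moreover have "sin (2*t) \<le> 2*t - (2*t)^3/6 + (2*t)^5/120"
    using t pi_bounds by (intro sin_taylor_bounds) auto
  moreover have "2 * (p - t)^2 * (t + t^3/3 + 2*t^5/15) \<le> 2 * (p - t)^2 * tan t"
    using t by (intro mult_left_mono tan_lower) auto
  moreover have "numer x = p - t + sin (2*t) / 2 - 2 * (p - t)^2 * tan t"
    unfolding x p_def by (rule numer_complement)
  ultimately show ?thesis
    unfolding t_def[symmetric] by (simp add: x power_mult_distrib)
qed

theorem theorem2p2:
  shows "\<forall>x\<in> {0<..<pi / 2}.
    2 + (16 / pi ^ 4 + c x) * x ^ 3 * tan x < (sin x / x) ^ 2 + tan x / x \<and>
    (sin x / x) ^ 2 + tan x / x < 2 + (16 / pi ^ 4 + d x) * x ^ 3 * tan x"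
proof
  fix x :: real
  assume "x \<in> {0<..<pi / 2}"
  then have x: "0 < x" "x < pi / 2" by auto
  have pos: "0 < tan x / x^2"
    using x by (intro divide_pos_pos tan_gt_zero) auto
  have "(16 / pi^4 + c x) * x^5 < numer x"
    using numer_lower[OF x] by (simp add: c_def power_divide)
  then have "0 < tan x / x^2 * (numer x - (16 / pi^4 + c x) * x^5)"
    using pos by (intro mult_pos_pos) auto
  moreover have "numer x < (16 / pi^4 + d x) * x^5"
    using numer_upper[OF x] by (simp add: d_def power_divide add.assoc)
  then have "tan x / x^2 * (numer x - (16 / pi^4 + d x) * x^5) < 0"
    using pos by (intro mult_pos_neg) auto
  ultimately show "2 + (16 / pi ^ 4 + c x) * x ^ 3 * tan x < (sin x / x) ^ 2 + tan x / x \<and>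
    (sin x / x) ^ 2 + tan x / x < 2 + (16 / pi ^ 4 + d x) * x ^ 3 * tan x"
    unfolding gap_factorisation[OF x, symmetric] by simp
qed

end
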